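(* Suppose that $V(r,z)=\|z-r\|^2/2$ for any $r,z\in Z$, where $\|\cdot\|$ is the norm induced by the inner product, that $L_H>0$, and let $u^*$ be a strong solution of $VI(Z;G,H,J)$ and $D:=\|r_1-u^*\|$. If $N\ge2$ is given and the parameters $\{\alpha_t\}$ and $\{\gamma_t\}$ in the AMP method are set to $$\alpha_t=\frac2{t+1}\quad\text{and}\quad\gamma_t=\frac{t}{3(L_G+L_HN)},$$ then there exist $v_N\in\mathcal E$ and $\varepsilon_N\ge 0$ such that $\tilde g(w^{ag}_N,v_N)\le\varepsilon_N$, $$\|v_N\|\le\left[\frac{12L_G}{N(N-1)}+\frac{12L_H}{N-1}\right]D\qquad\text{and}\qquad\varepsilon_N\le\left[\frac{45L_G}{N(N-1)}+\frac{45L_H}{N-1}\right]D^2 .$$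
   Context: Setting. $\mathcal E$ is a finite-dimensional real vector space with inner product $\langle\cdot,\cdot\rangle$ and induced norm $\|\cdot\|$; $Z\subset\mathcal E$ is a nonempty closed convex set (possibly unbounded). $G$ is continuously differentiable with $0\le G(w)-G(v)-\langle\nabla G(v),w-v\rangle\le\frac{L_G}{2}\|w-v\|^2$ for all $w,v\in Z$. $H:Z\to\mathcal E$ satisfies $\langle H(w)-H(v),w-v\rangle\ge0$ and $\|H(w)-H(v)\|\le L_H\|w-v\|$ for all $w,v\in Z$. $J$ is a real-valued convex function on $Z$ having a subgradient $J'(u)\in\partial J(u)$ at each $u\in Z$. $VI(Z;G,H,J)$ is the variational inequality with operator $F(u)=\nabla G(u)+H(u)+J'(u)$; a strong solution is a point $u^*\in Z$ with $\langle F(u^* ),u^*-u\rangle\le0$ for all $u\in Z$. Prox-mapping. For $z\in Z$, $\eta\in\mathcal E$, $\gamma>0$, $P_z^{\gamma J}(\eta)=\operatorname{argmin}_{u\in Z}\{\langle\eta,u-z\rangle+V(z,u)+\gamma J(u)\}$, assumed to be well defined. AMP method. Choose $r_1\in Z$ and set $w_1=w_1^{ag}=r_1$. For $t=1,2,\ldots,N-1$: $w_t^{md}=(1-\alpha_t)w_t^{ag}+\alpha_tr_t$; $w_{t+1}=P_{r_t}^{\gamma_tJ}(\gamma_tH(r_t)+\gamma_t\nabla G(w_t^{md}))$; $r_{t+1}=P_{r_t}^{\gamma_tJ}(\gamma_tH(w_{t+1})+\gamma_t\nabla G(w_t^{md}))$; $w_{t+1}^{ag}=(1-\alpha_t)w_t^{ag}+\alpha_tw_{t+1}$.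 Gap function. $Q(\tilde u,u)=G(\tilde u)-G(u)+\langle H(u),\tilde u-u\rangle+J(\tilde u)-J(u)$ for $\tilde u,u\in Z$, and $\tilde g(\tilde u,\tilde v)=\sup_{u\in Z}\{Q(\tilde u,u)-\langle\tilde v,\tilde u-u\rangle\}$ for $\tilde u\in Z$, $\tilde v\in\mathcal E$. *)

theory Defs
  imports "HOL-Analysis.Analysis"
begin

(* J is regarded as real-valued on Z only, i.e. as +infinity off Z; hence the subgradient
   inequality is required at the points of Z. *)
definition subdifferential :: "'a::euclidean_space set \<Rightarrow> ('a \<Rightarrow> real) \<Rightarrow> 'a \<Rightarrow> 'a set" where
  "subdifferential Z J u = {g. \<forall>w\<in>Z. J u + g \<bullet> (w - u) \<le> J w}"

definition vi_operator ::
  "('a::euclidean_space \<Rightarrow> 'a) \<Rightarrow> ('a \<Rightarrow> 'a) \<Rightarrow> ('a \<Rightarrow> 'a) \<Rightarrow> 'a \<Rightarrow> 'a" where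
  "vi_operator gradG H J' u = gradG u + H u + J' u"

definition strong_solution :: "'a::euclidean_space set \<Rightarrow> ('a \<Rightarrow> 'a) \<Rightarrow> 'a \<Rightarrow> bool" where
  "strong_solution Z F ustar \<longleftrightarrow> ustar \<in> Z \<and> (\<forall>u\<in>Z. F ustar \<bullet> (ustar - u) \<le> 0)"

definition prox_objective ::
  "('a::euclidean_space \<Rightarrow> 'a \<Rightarrow> real) \<Rightarrow> ('a \<Rightarrow> real) \<Rightarrow> real \<Rightarrow> 'a \<Rightarrow> 'a \<Rightarrow> 'a \<Rightarrow> real" where
  "prox_objective V J c z \<eta> u = \<eta> \<bullet> (u - z) + V z u + c * J u"

definition prox_mapping ::
  "'a::euclidean_space set \<Rightarrow> ('a \<Rightarrow> 'a \<Rightarrow> real) \<Rightarrow> ('a \<Rightarrow> real) \<Rightarrow> real \<Rightarrow> 'a \<Rightarrow> 'a \<Rightarrow> 'a" where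
  "prox_mapping Z V J c z \<eta> = arg_min_on (prox_objective V J c z \<eta>) Z"

(* arg_min_on is an arbitrary choice among the minimizers and is unspecified if there are none,
   so that the mapping being well defined is a separate condition. *)
definition prox_well_defined ::
  "'a::euclidean_space set \<Rightarrow> ('a \<Rightarrow> 'a \<Rightarrow> real) \<Rightarrow> ('a \<Rightarrow> real) \<Rightarrow> bool" where
  "prox_well_defined Z V J \<longleftrightarrow>
     (\<forall>z\<in>Z. \<forall>\<eta>. \<forall>c>0. \<exists>!u. is_arg_min (prox_objective V J c z \<eta>) (\<lambda>u. u \<in> Z) u)"

(* The sequences r, w, wag, wmd are N - 1 steps of the accelerated mirror-prox method.  They are
   indexed from 1; their values outside the range of the method are unconstrained. *)
definition amp_method ::
  "'a::euclidean_space set \<Rightarrow> ('a \<Rightarrow> 'a \<Rightarrow> real) \<Rightarrow> ('a \<Rightarrow> 'a) \<Rightarrow> ('a \<Rightarrow> 'a) \<Rightarrow> ('a \<Rightarrow> real) \<Rightarrow>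
   (nat \<Rightarrow> real) \<Rightarrow> (nat \<Rightarrow> real) \<Rightarrow> nat \<Rightarrow>
   (nat \<Rightarrow> 'a) \<Rightarrow> (nat \<Rightarrow> 'a) \<Rightarrow> (nat \<Rightarrow> 'a) \<Rightarrow> (nat \<Rightarrow> 'a) \<Rightarrow> bool" where
  "amp_method Z V gradG H J \<alpha> \<gamma> N r w wag wmd \<longleftrightarrow>
     r 1 \<in> Z \<and> w 1 = r 1 \<and> wag 1 = r 1 \<and>
     (\<forall>t\<in>{1..<N}.
        wmd t = (1 - \<alpha> t) *\<^sub>R wag t + \<alpha> t *\<^sub>R r t \<and>
        w (t + 1) = prox_mapping Z V J (\<gamma> t) (r t) (\<gamma> t *\<^sub>R H (r t) + \<gamma> t *\<^sub>R gradG (wmd t)) \<and>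
        r (t + 1) = prox_mapping Z V J (\<gamma> t) (r t) (\<gamma> t *\<^sub>R H (w (t + 1)) + \<gamma> t *\<^sub>R gradG (wmd t)) \<and>
        wag (t + 1) = (1 - \<alpha> t) *\<^sub>R wag t + \<alpha> t *\<^sub>R w (t + 1))"

definition gap_Q ::
  "('a::euclidean_space \<Rightarrow> real) \<Rightarrow> ('a \<Rightarrow> 'a) \<Rightarrow> ('a \<Rightarrow> real) \<Rightarrow> 'a \<Rightarrow> 'a \<Rightarrow> real" where
  "gap_Q G H J u' u = G u' - G u + H u \<bullet> (u' - u) + J u' - J u"

(* Extended-real valued, since the supremum may be infinite when Z is unbounded. *)
definition perturbed_gap ::
  "'a::euclidean_space set \<Rightarrow> ('a \<Rightarrow> real) \<Rightarrow> ('a \<Rightarrow> 'a) \<Rightarrow> ('a \<Rightarrow> real) \<Rightarrow> 'a \<Rightarrow> 'a \<Rightarrow> ereal" where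
  "perturbed_gap Z G H J u' v' = (SUP u\<in>Z. ereal (gap_Q G H J u' u - v' \<bullet> (u' - u)))"

end

theory Submission
  imports Defs
begin

text \<open>
  With \<open>M = L\<^sub>G + L\<^sub>H N\<close>, multiplying the one-step recursion for the gap by \<open>t (t + 1) / 2\<close> makes the
  coefficient of the telescoping term \<open>\<parallel>r\<^sub>t - u\<parallel>\<^sup>2 - \<parallel>r\<^sub>t\<^sub>+\<^sub>1 - u\<parallel>\<^sup>2\<close> the constant \<open>3 M / 2\<close>, so that for all \<open>u\<close>
  in \<open>Z\<close> the gap \<open>Q(w\<^sup>a\<^sup>g\<^sub>N, u)\<close> is at most \<open>c / 2 (\<parallel>r\<^sub>1 - u\<parallel>\<^sup>2 - \<parallel>r\<^sub>N - u\<parallel>\<^sup>2)\<close> with \<open>c = 6 M / (N (N - 1))\<close>.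
  The right-hand side is affine in \<open>u\<close>; expanding it around \<open>w\<^sup>a\<^sup>g\<^sub>N\<close> gives \<open>v = c (r\<^sub>1 - r\<^sub>N)\<close> and
  \<open>\<epsilon> = c / 2 (\<parallel>r\<^sub>1 - w\<^sup>a\<^sup>g\<^sub>N\<parallel>\<^sup>2 - \<parallel>r\<^sub>N - w\<^sup>a\<^sup>g\<^sub>N\<parallel>\<^sup>2)\<close>.  At \<open>u = u\<^sup>*\<close> the gap is nonnegative, which bounds both
  \<open>\<parallel>r\<^sub>t - u\<^sup>*\<parallel> \<le> D\<close> and \<open>\<parallel>w\<^sub>t\<^sub>+\<^sub>1 - r\<^sub>t\<parallel>\<^sup>2 \<le> 3 D\<^sup>2\<close>.
\<close>

section \<open>Optimality in the prox-mapping, and the sign of the gap at a solution\<close>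

lemma nonneg_of_add_small_nonneg:
  fixes a b :: real
  assumes "\<And>s. 0 < s \<Longrightarrow> s \<le> 1 \<Longrightarrow> 0 \<le> a + s * b"
  shows "0 \<le> a"
proof (rule tendsto_lowerbound)
  show "((\<lambda>s. a + s * b) \<longlongrightarrow> a) (at_right 0)"
    by (auto intro!: tendsto_eq_intros)
  show "\<forall>\<^sub>F s in at_right 0. 0 \<le> a + s * b"
    unfolding eventually_at_right_field using assms by (intro exI[of _ 1]) auto
qed simp

lemma three_point_identity:
  fixes w z u :: "'a::real_inner"
  shows "2 * ((w - z) \<bullet> (u - w)) = (norm (z - u))\<^sup>2 - (norm (w - u))\<^sup>2 - (norm (z - w))\<^sup>2"
  by (simp add: power2_norm_eq_inner inner_diff_left inner_diff_right inner_commute)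

text \<open>\<open>J\<close> need not be differentiable, so optimality is extracted along the
  segment from \<open>w\<close> to \<open>u\<close>: convexity bounds \<open>J\<close> there by its
  chord, the objective increment is divided by the segment parameter \<open>s\<close>, and
  \<open>s\<close> tends to 0. The resulting variational inequality becomes a difference of squared
  distances by \<open>three_point_identity\<close>.\<close>

lemma prox_three_point:
  fixes Z :: "'a::euclidean_space set" and J :: "'a \<Rightarrow> real"
  assumes "convex Z" and J: "convex_on Z J" and "0 < c"
    and V: "\<And>u. u \<in> Z \<Longrightarrow> V z u = (norm (u - z))\<^sup>2 / 2"
    and min: "is_arg_min (prox_objective V J c z \<eta>) (\<lambda>u. u \<in> Z) w" and u: "u \<in> Z"
  shows "\<eta> \<bullet> (w - u) + c * (J w - J u)
           \<le> ((norm (z - u))\<^sup>2 - (norm (w - u))\<^sup>2 - (norm (z - w))\<^sup>2) / 2"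
proof -
  have w: "w \<in> Z" and min': "\<And>y. y \<in> Z \<Longrightarrow> prox_objective V J c z \<eta> w \<le> prox_objective V J c z \<eta> y"
    using min by (auto simp: is_arg_min_linorder)
  have "0 \<le> (\<eta> + (w - z)) \<bullet> (u - w) + c * (J u - J w)" (is "0 \<le> ?A")
  proof (rule nonneg_of_add_small_nonneg)
    fix s :: real assume s: "0 < s" "s \<le> 1"
    define y where "y = (1 - s) *\<^sub>R w + s *\<^sub>R u"
    have y_diff: "y - z = (w - z) + s *\<^sub>R (u - w)"
      by (simp add: y_def algebra_simps)
    have y: "y \<in> Z"
      unfolding y_def using \<open>convex Z\<close> w u s by (intro convexD) auto
    have "J y \<le> (1 - s) * J w + s * J u"
      unfolding y_def using convex_onD[OF J, of s w u] w u s by simp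
    then have "c * J y \<le> c * ((1 - s) * J w + s * J u)"
      using \<open>0 < c\<close> by simp
    moreover have "(norm (y - z))\<^sup>2 = (norm (w - z))\<^sup>2 + 2 * s * ((w - z) \<bullet> (u - w)) + s\<^sup>2 * (norm (u - w))\<^sup>2"
      unfolding y_diff power2_norm_eq_inner
      by (simp only: inner_add_left inner_add_right inner_scaleR_left inner_scaleR_right
            inner_commute[of "u - w" "w - z"] power2_eq_square) algebra
    moreover have "\<eta> \<bullet> (y - z) = \<eta> \<bullet> (w - z) + s * (\<eta> \<bullet> (u - w))"
      unfolding y_diff by (simp add: inner_add_right)
    ultimately have "0 \<le> s * (\<eta> \<bullet> (u - w)) + s * ((w - z) \<bullet> (u - w)) + s\<^sup>2 * (norm (u - w))\<^sup>2 / 2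
                          + c * (s * (J u - J w))"
      using min'[OF y] V[OF w] V[OF y] by (simp add: prox_objective_def algebra_simps)
    \<comment> \<open>The only second-order term is the quadratic one from \<open>V\<close>; it
      vanishes in the limit.\<close>
    then have "0 \<le> s * (?A + s * ((norm (u - w))\<^sup>2 / 2))"
      by (simp add: inner_add_left power2_eq_square algebra_simps)
    then show "0 \<le> ?A + s * ((norm (u - w))\<^sup>2 / 2)"
      using s by (simp add: zero_le_mult_iff)
  qed
  then show ?thesis
    using three_point_identity[of w z u] by (simp add: inner_add_left inner_diff_right algebra_simps)
qed

text \<open>Serves the case where \<open>Z\<close> is a single point: there the stepsizes may fail
  to be positive, so \<open>prox_well_defined\<close> gives no information about the
  iterates.\<close>

lemma arg_min_on_singleton:
  fixes f :: "'a \<Rightarrow> 'b::preorder"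
  shows "arg_min_on f {z} = z"
  unfolding arg_min_on_def arg_min_def by (rule some_equality) (auto simp: is_arg_min_def)

text \<open>Linearizing \<open>G\<close> and \<open>J\<close> from below at \<open>ustar\<close>
  bounds the gap below by the inner product of the operator at \<open>ustar\<close> with
  \<open>u - ustar\<close>, which is nonnegative at a strong solution.\<close>

lemma strong_solution_gap_nonneg:
  assumes sol: "strong_solution Z (vi_operator gradG H J') ustar" and u: "u \<in> Z"
    and G: "0 \<le> G u - G ustar - gradG ustar \<bullet> (u - ustar)"
    and J: "J' ustar \<in> subdifferential Z J ustar"
  shows "0 \<le> gap_Q G H J u ustar"
proof -
  have "(gradG ustar + H ustar + J' ustar) \<bullet> (ustar - u) \<le> 0"
    using sol u by (auto simp: strong_solution_def vi_operator_def)
  moreover have "J ustar + J' ustar \<bullet> (u - ustar) \<le> J u"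
    using J u by (auto simp: subdifferential_def)
  ultimately show ?thesis
    using G by (simp add: gap_Q_def inner_add_left inner_diff_right)
qed

lemma norm_convex_combination_diff_le:
  fixes x :: "'a::real_normed_vector"
  assumes "norm (x - a) \<le> d" "norm (y - a) \<le> d" "0 \<le> t" "t \<le> (1::real)"
  shows "norm (((1 - t) *\<^sub>R x + t *\<^sub>R y) - a) \<le> d"
  using convexD_alt[OF convex_cball, of x a d y t] assms by (simp add: dist_norm norm_minus_commute)

section \<open>One step of the method, compared with an arbitrary point \<open>u\<close> of
  \<open>Z\<close>\<close>

locale composite_vi =
  fixes Z :: "'a::euclidean_space set"
    and G :: "'a \<Rightarrow> real" and gradG :: "'a \<Rightarrow> 'a"
    and H :: "'a \<Rightarrow> 'a"
    and J :: "'a \<Rightarrow> real"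
    and V :: "'a \<Rightarrow> 'a \<Rightarrow> real"
    and L\<^sub>G L\<^sub>H :: real
  assumes Z: "convex Z"
    and G_lower: "\<And>w v. w \<in> Z \<Longrightarrow> v \<in> Z \<Longrightarrow> 0 \<le> G w - G v - gradG v \<bullet> (w - v)"
    and G_upper: "\<And>w v. w \<in> Z \<Longrightarrow> v \<in> Z \<Longrightarrow>
                    G w - G v - gradG v \<bullet> (w - v) \<le> L\<^sub>G / 2 * (norm (w - v))\<^sup>2"
    and H_mono: "\<And>w v. w \<in> Z \<Longrightarrow> v \<in> Z \<Longrightarrow> 0 \<le> (H w - H v) \<bullet> (w - v)"
    and H_lipschitz: "\<And>w v. w \<in> Z \<Longrightarrow> v \<in> Z \<Longrightarrow> norm (H w - H v) \<le> L\<^sub>H * norm (w - v)"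
    and J_convex: "convex_on Z J"
    and prox: "prox_well_defined Z V J"
    and V: "\<And>r z. r \<in> Z \<Longrightarrow> z \<in> Z \<Longrightarrow> V r z = (norm (z - r))\<^sup>2 / 2"
begin

lemma prox_mapping_arg_min:
  assumes "z \<in> Z" "0 < c"
  shows "is_arg_min (prox_objective V J c z \<eta>) (\<lambda>u. u \<in> Z) (prox_mapping Z V J c z \<eta>)"
  using prox assms unfolding prox_well_defined_def prox_mapping_def arg_min_on_def arg_min_def
  by (meson someI)

lemma prox_mapping_in:
  assumes "z \<in> Z" "0 < c"
  shows "prox_mapping Z V J c z \<eta> \<in> Z"
  using prox_mapping_arg_min[OF assms] by (simp add: is_arg_min_def)

lemma prox_mapping_three_point:
  fixes \<eta> :: 'a
  assumes "z \<in> Z" "0 < c" "u \<in> Z"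
  defines "w \<equiv> prox_mapping Z V J c z \<eta>"
  shows "\<eta> \<bullet> (w - u) + c * (J w - J u)
           \<le> ((norm (z - u))\<^sup>2 - (norm (w - u))\<^sup>2 - (norm (z - w))\<^sup>2) / 2"
  unfolding w_def
  by (rule prox_three_point[OF Z J_convex assms(2) V[OF assms(1)] prox_mapping_arg_min[OF assms(1,2)] assms(3)])

text \<open>The prediction \<open>w\<close> is tested at the correction \<open>r'\<close>, and
  \<open>r'\<close> is tested at \<open>u\<close>. The sum of the two prox inequalities misses the
  target by the inner product of \<open>p\<close> with \<open>w - r'\<close>, the price of having
  used \<open>H r\<close> instead of \<open>H w\<close>. Young's inequality absorbs it into the
  available term in \<open>w - r'\<close>, and the Lipschitz bound on \<open>H\<close> controls what
  remains.\<close>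

lemma extragradient_step:
  fixes g :: 'a
  assumes "0 < c" and r: "r \<in> Z" and u: "u \<in> Z"
  defines "w \<equiv> prox_mapping Z V J c r (c *\<^sub>R H r + c *\<^sub>R g)"
  defines "r' \<equiv> prox_mapping Z V J c r (c *\<^sub>R H w + c *\<^sub>R g)"
  shows "c * ((H w + g) \<bullet> (w - u) + J w - J u)
           \<le> ((norm (r - u))\<^sup>2 - (norm (r' - u))\<^sup>2 - (1 - c\<^sup>2 * L\<^sub>H\<^sup>2) * (norm (w - r))\<^sup>2) / 2"
proof -
  have w: "w \<in> Z" and r': "r' \<in> Z"
    unfolding w_def r'_def using r \<open>0 < c\<close> by (auto intro: prox_mapping_in)
  define p where "p = c *\<^sub>R (H w - H r)"
  have 1: "(c *\<^sub>R H r + c *\<^sub>R g) \<bullet> (w - r') + c * (J w - J r')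
            \<le> ((norm (r - r'))\<^sup>2 - (norm (w - r'))\<^sup>2 - (norm (r - w))\<^sup>2) / 2"
    unfolding w_def by (rule prox_mapping_three_point[OF r \<open>0 < c\<close> r'])
  have 2: "(c *\<^sub>R H w + c *\<^sub>R g) \<bullet> (r' - u) + c * (J r' - J u)
            \<le> ((norm (r - u))\<^sup>2 - (norm (r' - u))\<^sup>2 - (norm (r - r'))\<^sup>2) / 2"
    unfolding r'_def by (rule prox_mapping_three_point[OF r \<open>0 < c\<close> u])
  have "0 \<le> (norm (p - (w - r')))\<^sup>2"
    by simp
  then have 3: "2 * (p \<bullet> (w - r')) \<le> (norm p)\<^sup>2 + (norm (w - r'))\<^sup>2"
    unfolding power2_norm_eq_inner by (simp add: inner_diff_left inner_diff_right inner_commute)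
  have "norm p \<le> c * (L\<^sub>H * norm (w - r))"
    unfolding p_def using H_lipschitz[OF w r] \<open>0 < c\<close> by simp
  then have "(norm p)\<^sup>2 \<le> (c * (L\<^sub>H * norm (w - r)))\<^sup>2"
    by (intro power_mono) auto
  then have 4: "(norm p)\<^sup>2 \<le> c\<^sup>2 * L\<^sub>H\<^sup>2 * (norm (w - r))\<^sup>2"
    by (simp add: power_mult_distrib mult.assoc)
  have "c * ((H w + g) \<bullet> (w - u) + J w - J u)
      = ((c *\<^sub>R H r + c *\<^sub>R g) \<bullet> (w - r') + c * (J w - J r'))
        + ((c *\<^sub>R H w + c *\<^sub>R g) \<bullet> (r' - u) + c * (J r' - J u)) + p \<bullet> (w - r')"
    by (simp add: p_def algebra_simps inner_add_left inner_diff_left inner_diff_right)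
  with 1 2 3 4 show ?thesis
    by (simp add: norm_minus_commute[of r w] algebra_simps)
qed

text \<open>Here \<open>x\<close> and \<open>x'\<close> are consecutive aggregate points and
  \<open>m\<close> is the middle point. \<open>G\<close> is linearized at \<open>m\<close>: the
  upper bound is used at \<open>x'\<close>, the lower bound at \<open>x\<close> and
  \<open>u\<close>. The linear terms left over are those of \<open>extragradient_step\<close>,
  scaled by \<open>a / c\<close>.\<close>

lemma gap_step:
  assumes c: "0 < c" and a: "0 \<le> a" "a \<le> 1" and r: "r \<in> Z" and x: "x \<in> Z" and u: "u \<in> Z"
  defines "m \<equiv> (1 - a) *\<^sub>R x + a *\<^sub>R r"
  defines "w \<equiv> prox_mapping Z V J c r (c *\<^sub>R H r + c *\<^sub>R gradG m)"
  defines "r' \<equiv> prox_mapping Z V J c r (c *\<^sub>R H w + c *\<^sub>R gradG m)"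
  defines "x' \<equiv> (1 - a) *\<^sub>R x + a *\<^sub>R w"
  shows "gap_Q G H J x' u \<le> (1 - a) * gap_Q G H J x u
           + a / (2 * c) * ((norm (r - u))\<^sup>2 - (norm (r' - u))\<^sup>2
                            - (1 - c\<^sup>2 * L\<^sub>H\<^sup>2 - L\<^sub>G * a * c) * (norm (w - r))\<^sup>2)"
proof -
  have w: "w \<in> Z"
    unfolding w_def using r c by (auto intro: prox_mapping_in)
  have m: "m \<in> Z" and x': "x' \<in> Z"
    unfolding m_def x'_def using Z a r x w by (auto intro!: convexD)
  let ?g = "gradG m"
  have G: "G x' \<le> (1 - a) * G x + a * G u + a * (?g \<bullet> (w - u)) + L\<^sub>G / 2 * a\<^sup>2 * (norm (w - r))\<^sup>2"
  proof -
    \<comment> \<open>Both averages share the part \<open>(1 - a) *\<^sub>R x\<close>, so the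
      smoothness error carries a factor \<open>a\<^sup>2\<close>; this is the source of the
      acceleration.\<close>
    have "x' - m = a *\<^sub>R (w - r)"
      by (simp add: x'_def m_def algebra_simps)
    then have "(norm (x' - m))\<^sup>2 = a\<^sup>2 * (norm (w - r))\<^sup>2"
      by (simp add: power_mult_distrib)
    then have "G x' \<le> G m + ?g \<bullet> (x' - m) + L\<^sub>G / 2 * a\<^sup>2 * (norm (w - r))\<^sup>2"
      using G_upper[OF x' m] by simp
    moreover have "(1 - a) * (G m + ?g \<bullet> (x - m)) \<le> (1 - a) * G x"
      using G_lower[OF x m] a by (intro mult_left_mono) auto
    moreover have "a * (G m + ?g \<bullet> (u - m)) \<le> a * G u"
      using G_lower[OF u m] a by (intro mult_left_mono) auto
    moreover have "?g \<bullet> (x' - m) = (1 - a) * (?g \<bullet> (x - m)) + a * (?g \<bullet> (u - m)) + a * (?g \<bullet> (w - u))"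
      by (simp add: x'_def inner_add_right inner_diff_right algebra_simps)
    ultimately show ?thesis
      by (simp add: algebra_simps)
  qed
  have J: "J x' \<le> (1 - a) * J x + a * J w"
    unfolding x'_def using convex_onD[OF J_convex, of a x w] a x w by simp
  have H: "H u \<bullet> (x' - u) \<le> (1 - a) * (H u \<bullet> (x - u)) + a * (H w \<bullet> (w - u))"
  proof -
    have "H u \<bullet> (x' - u) = (1 - a) * (H u \<bullet> (x - u)) + a * (H u \<bullet> (w - u))"
      by (simp add: x'_def inner_add_right inner_diff_right algebra_simps)
    \<comment> \<open>Monotonicity trades \<open>H u\<close>, which occurs in the gap, for
      \<open>H w\<close>, which the prox step controls.\<close>
    moreover have "a * (H u \<bullet> (w - u)) \<le> a * (H w \<bullet> (w - u))"
      using H_mono[OF w u] a by (intro mult_left_mono) (auto simp: inner_diff_left)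
    ultimately show ?thesis by simp
  qed
  let ?S = "(norm (r - u))\<^sup>2 - (norm (r' - u))\<^sup>2 - (1 - c\<^sup>2 * L\<^sub>H\<^sup>2) * (norm (w - r))\<^sup>2"
  have "a / c * (c * ((H w + ?g) \<bullet> (w - u) + J w - J u)) \<le> a / c * (?S / 2)"
    unfolding w_def r'_def using a c by (intro mult_left_mono extragradient_step r u) auto
  then have E: "a * ((H w + ?g) \<bullet> (w - u) + J w - J u) \<le> a / (2 * c) * ?S"
    using c by simp
  let ?d = "(norm (w - r))\<^sup>2"
  have eq: "a / (2 * c) * ?S + L\<^sub>G / 2 * a\<^sup>2 * ?d
      = a / (2 * c) * ((norm (r - u))\<^sup>2 - (norm (r' - u))\<^sup>2 - (1 - c\<^sup>2 * L\<^sub>H\<^sup>2 - L\<^sub>G * a * c) * ?d)"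
  proof -
    have "L\<^sub>G / 2 * a\<^sup>2 * ?d = a / (2 * c) * (L\<^sub>G * a * c * ?d)"
      using c by (simp add: power2_eq_square)
    then have "a / (2 * c) * ?S + L\<^sub>G / 2 * a\<^sup>2 * ?d = a / (2 * c) * (?S + L\<^sub>G * a * c * ?d)"
      by (simp only: distrib_left)
    also have "?S + L\<^sub>G * a * c * ?d
        = (norm (r - u))\<^sup>2 - (norm (r' - u))\<^sup>2 - (1 - c\<^sup>2 * L\<^sub>H\<^sup>2 - L\<^sub>G * a * c) * ?d"
      by (simp add: left_diff_distrib)
    finally show ?thesis .
  qed
  have "gap_Q G H J x' u \<le> (1 - a) * gap_Q G H J x u
      + a * ((H w + ?g) \<bullet> (w - u) + J w - J u) + L\<^sub>G / 2 * a\<^sup>2 * ?d"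
    using G J H by (simp add: gap_Q_def algebra_simps inner_add_left)
  also have "\<dots> \<le> (1 - a) * gap_Q G H J x u + a / (2 * c) * ?S + L\<^sub>G / 2 * a\<^sup>2 * ?d"
    by (intro add_mono E order_refl)
  finally show ?thesis
    by (simp only: eq add.assoc)
qed

end

section \<open>Telescoping with the prescribed parameters\<close>

locale amp_run = composite_vi Z G gradG H J V L\<^sub>G L\<^sub>H
  for Z :: "'a::euclidean_space set" and G gradG H J V L\<^sub>G L\<^sub>H +
  fixes \<alpha> \<gamma> :: "nat \<Rightarrow> real" and N :: nat and r w wag wmd :: "nat \<Rightarrow> 'a"
  assumes L\<^sub>G_nonneg: "0 \<le> L\<^sub>G" and L\<^sub>H_pos: "0 < L\<^sub>H"
    and \<alpha>: "\<And>t. t \<in> {1..<N} \<Longrightarrow> \<alpha> t = 2 / (real t + 1)"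
    and \<gamma>: "\<And>t. t \<in> {1..<N} \<Longrightarrow> \<gamma> t = real t / (3 * (L\<^sub>G + L\<^sub>H * real N))"
    and amp: "amp_method Z V gradG H J \<alpha> \<gamma> N r w wag wmd"
begin

definition M :: real where "M = L\<^sub>G + L\<^sub>H * real N"

lemma M_pos: "1 \<le> N \<Longrightarrow> 0 < M"
  using L\<^sub>G_nonneg L\<^sub>H_pos by (simp add: M_def add_nonneg_pos)

lemma \<alpha>_bounds: "t \<in> {1..<N} \<Longrightarrow> 0 \<le> \<alpha> t \<and> \<alpha> t \<le> 1"
  by (simp add: \<alpha> field_simps)

lemma \<gamma>_eq: "t \<in> {1..<N} \<Longrightarrow> \<gamma> t = real t / (3 * M)"
  by (simp only: \<gamma> M_def)

lemma \<gamma>_pos: "t \<in> {1..<N} \<Longrightarrow> 0 < \<gamma> t"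
  using M_pos by (simp add: \<gamma>_eq)

lemma iterates_in: "t \<in> {1..N} \<Longrightarrow> r t \<in> Z \<and> w t \<in> Z \<and> wag t \<in> Z"
proof (induction t)
  case (Suc t)
  show ?case
  proof (cases "t = 0")
    case True
    then show ?thesis using amp by (simp add: amp_method_def)
  next
    case False
    then have t: "t \<in> {1..<N}" and IH: "r t \<in> Z" "wag t \<in> Z"
      using Suc by auto
    have "w (Suc t) \<in> Z" "r (Suc t) \<in> Z"
      using amp t IH \<gamma>_pos[OF t] by (auto simp: amp_method_def intro!: prox_mapping_in)
    moreover have "wag (Suc t) = (1 - \<alpha> t) *\<^sub>R wag t + \<alpha> t *\<^sub>R w (Suc t)"
      using amp t by (simp add: amp_method_def)
    ultimately show ?thesis
      using \<alpha>_bounds[OF t] IH Z by (auto intro!: convexD)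
  qed
qed simp

text \<open>With the shares \<open>x\<close> and \<open>y\<close> of \<open>L\<^sub>H * N\<close>
  and \<open>L\<^sub>G\<close> in \<open>M\<close>, the two losses are at most
  \<open>x\<^sup>2 / 9\<close> and \<open>2 * y / 3\<close>. Since \<open>x\<^sup>2 \<le> x\<close>
  and \<open>y = 1 - x\<close>, at least \<open>1 / 3 + 5 * x / 9\<close> is left.\<close>

lemma stepsize_bound:
  assumes t: "t \<in> {1..<N}"
  shows "1 / 3 \<le> 1 - (\<gamma> t)\<^sup>2 * L\<^sub>H\<^sup>2 - L\<^sub>G * \<alpha> t * \<gamma> t"
proof -
  have M: "0 < M" using t M_pos by simp
  define x y where "x = L\<^sub>H * real N / M" and "y = L\<^sub>G / M"
  have "x + y = M / M"
    unfolding x_def y_def add_divide_distrib[symmetric] by (simp only: M_def add.commute)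
  then have sum: "x + y = 1"
    using M by simp
  have "0 \<le> x" "0 \<le> y"
    using M L\<^sub>G_nonneg L\<^sub>H_pos by (auto simp: x_def y_def)
  with sum have xy: "0 \<le> x" "0 \<le> y" "x \<le> 1" "y = 1 - x"
    by linarith+
  have "\<gamma> t * L\<^sub>H = L\<^sub>H * real t / M / 3"
    by (simp add: \<gamma>_eq[OF t] mult.commute)
  also have "\<dots> \<le> x / 3"
    unfolding x_def using M L\<^sub>H_pos t by (intro divide_right_mono mult_left_mono) auto
  finally have "(\<gamma> t * L\<^sub>H)\<^sup>2 \<le> (x / 3)\<^sup>2"
    using \<gamma>_pos[OF t] L\<^sub>H_pos by (intro power_mono) auto
  moreover have "L\<^sub>G * \<alpha> t * \<gamma> t \<le> 2 / 3 * y"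
  proof -
    have "L\<^sub>G * \<alpha> t * \<gamma> t = 2 / 3 * y * (real t / (real t + 1))"
      using t by (simp add: \<alpha> \<gamma>_eq y_def ac_simps)
    also have "\<dots> \<le> 2 / 3 * y * 1"
      using xy by (intro mult_left_mono) auto
    finally show ?thesis by simp
  qed
  moreover have "x\<^sup>2 \<le> x"
    unfolding power2_eq_square by (rule mult_left_le[OF xy(3,1)])
  moreover have "(x / 3)\<^sup>2 = x\<^sup>2 / 9"
    by (simp add: power_divide)
  ultimately show ?thesis
    using xy(1,4) unfolding power_mult_distrib by linarith
qed

text \<open>The weight \<open>t * (t - 1) / 2\<close> vanishes at \<open>t = 1\<close>, so the
  induction starts with an equality and no initial gap enters. The sum of squared steps, with the
  factor \<open>1 / 3\<close> from \<open>stepsize_bound\<close>, is retained because it later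
  controls how far \<open>w (t + 1)\<close> can move from \<open>r t\<close>.\<close>

lemma weighted_gap_bound:
  assumes "t \<in> {1..N}" and u: "u \<in> Z"
  shows "real t * (real t - 1) / 2 * gap_Q G H J (wag t) u
           + 3 * M / 2 * ((norm (r t - u))\<^sup>2 + (\<Sum>s\<in>{1..<t}. (norm (w (s + 1) - r s))\<^sup>2) / 3)
         \<le> 3 * M / 2 * (norm (r 1 - u))\<^sup>2"
  using \<open>t \<in> {1..N}\<close>
proof (induction t)
  case (Suc t)
  show ?case
  proof (cases "t = 0")
    case True
    then show ?thesis by simp
  next
    case False
    then have t: "t \<in> {1..<N}" and IH: "real t * (real t - 1) / 2 * gap_Q G H J (wag t) u
           + 3 * M / 2 * ((norm (r t - u))\<^sup>2 + (\<Sum>s\<in>{1..<t}. (norm (w (s + 1) - r s))\<^sup>2) / 3)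
         \<le> 3 * M / 2 * (norm (r 1 - u))\<^sup>2"
      using Suc by auto
    have M: "0 < M" using t M_pos by simp
    define e where "e = 1 - (\<gamma> t)\<^sup>2 * L\<^sub>H\<^sup>2 - L\<^sub>G * \<alpha> t * \<gamma> t"
    have e: "1 / 3 \<le> e" unfolding e_def by (rule stepsize_bound[OF t])
    let ?d = "(norm (w (t + 1) - r t))\<^sup>2"
    let ?S = "(norm (r t - u))\<^sup>2 - (norm (r (t + 1) - u))\<^sup>2"
    let ?k = "real t * (real t + 1) / 2"
    have it: "wmd t = (1 - \<alpha> t) *\<^sub>R wag t + \<alpha> t *\<^sub>R r t"
      "w (t + 1) = prox_mapping Z V J (\<gamma> t) (r t) (\<gamma> t *\<^sub>R H (r t) + \<gamma> t *\<^sub>R gradG (wmd t))"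
      "r (t + 1) = prox_mapping Z V J (\<gamma> t) (r t) (\<gamma> t *\<^sub>R H (w (t + 1)) + \<gamma> t *\<^sub>R gradG (wmd t))"
      "wag (t + 1) = (1 - \<alpha> t) *\<^sub>R wag t + \<alpha> t *\<^sub>R w (t + 1)"
      using amp t by (auto simp: amp_method_def)
    have "gap_Q G H J (wag (t + 1)) u
        \<le> (1 - \<alpha> t) * gap_Q G H J (wag t) u + \<alpha> t / (2 * \<gamma> t) * (?S - e * ?d)"
      using gap_step[of "\<gamma> t" "\<alpha> t" "r t" "wag t" u] \<gamma>_pos[OF t] \<alpha>_bounds[OF t] iterates_in[of t] t u
      unfolding e_def it(4) it(3) it(2) it(1) by simp
    then have "?k * gap_Q G H J (wag (t + 1)) u
        \<le> ?k * ((1 - \<alpha> t) * gap_Q G H J (wag t) u + \<alpha> t / (2 * \<gamma> t) * (?S - e * ?d))"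
      by (intro mult_left_mono) auto
    also have "\<dots> = (?k * (1 - \<alpha> t)) * gap_Q G H J (wag t) u + (?k * (\<alpha> t / (2 * \<gamma> t))) * (?S - e * ?d)"
      by (simp only: distrib_left mult.assoc)
    \<comment> \<open>The choice of \<alpha> makes the new weight, shrunk by
      \<open>1 - \<alpha> t\<close>, exactly the old weight.\<close>
    also have "?k * (1 - \<alpha> t) = real t * (real t - 1) / 2"
      using t by (simp add: \<alpha> field_simps)
    also have "?k * (\<alpha> t / (2 * \<gamma> t)) = 3 * M / 2"
      using t by (simp add: \<alpha> \<gamma>_eq)
    also have "3 * M / 2 * (?S - e * ?d) \<le> 3 * M / 2 * (?S - 1 / 3 * ?d)"
      using M e by (intro mult_left_mono diff_left_mono mult_right_mono) auto
    finally have "?k * gap_Q G H J (wag (t + 1)) u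
        \<le> real t * (real t - 1) / 2 * gap_Q G H J (wag t) u + 3 * M / 2 * (?S - 1 / 3 * ?d)"
      by simp
    moreover have "3 * M / 2 * ((norm (r (t + 1) - u))\<^sup>2 + (\<Sum>s\<in>{1..<t + 1}. (norm (w (s + 1) - r s))\<^sup>2) / 3)
        = 3 * M / 2 * ((norm (r t - u))\<^sup>2 + (\<Sum>s\<in>{1..<t}. (norm (w (s + 1) - r s))\<^sup>2) / 3)
          - 3 * M / 2 * (?S - 1 / 3 * ?d)"
    proof -
      have "(\<Sum>s\<in>{1..<t + 1}. (norm (w (s + 1) - r s))\<^sup>2)
          = (\<Sum>s\<in>{1..<t}. (norm (w (s + 1) - r s))\<^sup>2) + ?d"
        using t by simp
      then show ?thesis
        by (simp only: right_diff_distrib[symmetric]) simp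
    qed
    ultimately have "?k * gap_Q G H J (wag (t + 1)) u
        + 3 * M / 2 * ((norm (r (t + 1) - u))\<^sup>2 + (\<Sum>s\<in>{1..<t + 1}. (norm (w (s + 1) - r s))\<^sup>2) / 3)
      \<le> 3 * M / 2 * (norm (r 1 - u))\<^sup>2"
      using IH by linarith
    moreover have "real (Suc t) * (real (Suc t) - 1) / 2 = ?k"
      by simp
    ultimately show ?thesis
      by (simp only: Suc_eq_plus1)
  qed
qed simp

section \<open>Distances to a strong solution and the resulting perturbed gap\<close>

context
  fixes J' :: "'a \<Rightarrow> 'a" and ustar :: 'a
  assumes solution: "strong_solution Z (vi_operator gradG H J') ustar"
    and subgradient: "J' ustar \<in> subdifferential Z J ustar"
begin

lemma distances_to_solution:
  assumes t: "t \<in> {1..N}"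
  shows "(norm (r t - ustar))\<^sup>2 + (\<Sum>s\<in>{1..<t}. (norm (w (s + 1) - r s))\<^sup>2) / 3 \<le> (norm (r 1 - ustar))\<^sup>2"
proof -
  have u: "ustar \<in> Z" using solution by (simp add: strong_solution_def)
  have "0 \<le> gap_Q G H J (wag t) ustar"
    using iterates_in[OF t] u
    by (intro strong_solution_gap_nonneg[OF solution] subgradient G_lower) auto
  then have "0 \<le> real t * (real t - 1) / 2 * gap_Q G H J (wag t) ustar"
    using t by (intro mult_nonneg_nonneg) auto
  with weighted_gap_bound[OF t u]
  have "3 * M / 2 * ((norm (r t - ustar))\<^sup>2 + (\<Sum>s\<in>{1..<t}. (norm (w (s + 1) - r s))\<^sup>2) / 3)
       \<le> 3 * M / 2 * (norm (r 1 - ustar))\<^sup>2" by linarith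
  then show ?thesis
    using M_pos t by (simp add: mult_le_cancel_left_pos del: distrib_left_numeral)
qed

lemma r_bound:
  assumes t: "t \<in> {1..N}"
  shows "norm (r t - ustar) \<le> norm (r 1 - ustar)"
proof (rule power2_le_imp_le)
  have "0 \<le> (\<Sum>s\<in>{1..<t}. (norm (w (s + 1) - r s))\<^sup>2)"
    by (intro sum_nonneg) auto
  then show "(norm (r t - ustar))\<^sup>2 \<le> (norm (r 1 - ustar))\<^sup>2"
    using distances_to_solution[OF t] by linarith
qed simp

lemma w_bound:
  assumes t: "t \<in> {1..<N}"
  shows "norm (w (t + 1) - ustar) \<le> 14 / 5 * norm (r 1 - ustar)"
proof -
  let ?D = "norm (r 1 - ustar)"
  have "(norm (w (t + 1) - r t))\<^sup>2 \<le> (\<Sum>s\<in>{1..<t + 1}. (norm (w (s + 1) - r s))\<^sup>2)"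
    using t by (intro member_le_sum) auto
  moreover have "t + 1 \<in> {1..N}" using t by simp
  ultimately have "(norm (w (t + 1) - r t))\<^sup>2 \<le> 3 * ?D\<^sup>2"
    using distances_to_solution[of "t + 1"] zero_le_power2[of "norm (r (t + 1) - ustar)"] by linarith
  \<comment> \<open>\<open>9 / 5\<close> is a rational upper bound for the square root of 3; adding
    1 for \<open>r t\<close> gives the constant \<open>14 / 5\<close>.\<close>
  also have "\<dots> \<le> (9 / 5 * ?D)\<^sup>2"
    by (simp add: power2_eq_square)
  finally have "norm (w (t + 1) - r t) \<le> 9 / 5 * ?D"
    by (rule power2_le_imp_le) simp
  moreover have "norm (r t - ustar) \<le> ?D"
    using t by (intro r_bound) simp
  ultimately show ?thesis
    using norm_triangle_ineq[of "w (t + 1) - r t" "r t - ustar"] by simp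
qed

text \<open>The aggregates start at \<open>r 1\<close> and are then convex combinations of points in
  one ball around \<open>ustar\<close>.\<close>

lemma wag_bound: "t \<in> {1..N} \<Longrightarrow> norm (wag t - ustar) \<le> 14 / 5 * norm (r 1 - ustar)"
proof (induction t)
  case (Suc t)
  show ?case
  proof (cases "t = 0")
    case True
    then show ?thesis using amp by (simp add: amp_method_def)
  next
    case False
    then have t: "t \<in> {1..<N}" using Suc by auto
    have "wag (Suc t) = (1 - \<alpha> t) *\<^sub>R wag t + \<alpha> t *\<^sub>R w (t + 1)"
      using amp t by (simp add: amp_method_def)
    moreover have "norm (wag t - ustar) \<le> 14 / 5 * norm (r 1 - ustar)"
      using Suc.IH t by simp
    ultimately show ?thesis
      using \<alpha>_bounds[OF t] w_bound[OF t] by (simp only: norm_convex_combination_diff_le)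
  qed
qed simp

text \<open>\<open>c / 2\<close> is \<open>3 * M / 2\<close> divided by the final weight
  \<open>N * (N - 1) / 2\<close>. The factor 2 arises because \<open>r 1\<close> and
  \<open>r N\<close> both lie within \<open>D\<close> of \<open>ustar\<close>; the factor
  \<open>15 / 2\<close> comes from \<open>1 + 14 / 5 = 19 / 5\<close>, whose square is below
  15.\<close>

lemma perturbed_gap_bounds:
  assumes "2 \<le> N"
  defines "D \<equiv> norm (r 1 - ustar)"
  defines "c \<equiv> 6 * M / (real N * (real N - 1))"
  shows "\<exists>v \<epsilon>. 0 \<le> \<epsilon> \<and> perturbed_gap Z G H J (wag N) v \<le> ereal \<epsilon> \<and>
           norm v \<le> 2 * c * D \<and> \<epsilon> \<le> 15 / 2 * c * D\<^sup>2"
proof -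
  have N: "N \<in> {1..N}" and M: "0 < M" using assms(1) M_pos by auto
  have c: "0 < c" using assms(1) M by (simp add: c_def)
  define v where "v = c *\<^sub>R (r 1 - r N)"
  define \<epsilon> where "\<epsilon> = c / 2 * ((norm (r 1 - wag N))\<^sup>2 - (norm (r N - wag N))\<^sup>2)"
  have gap: "gap_Q G H J (wag N) u - v \<bullet> (wag N - u) \<le> \<epsilon>" if u: "u \<in> Z" for u
  proof -
    have "0 \<le> (\<Sum>s\<in>{1..<N}. (norm (w (s + 1) - r s))\<^sup>2)"
      by (intro sum_nonneg) auto
    then have "3 * M / 2 * (norm (r N - u))\<^sup>2
        \<le> 3 * M / 2 * ((norm (r N - u))\<^sup>2 + (\<Sum>s\<in>{1..<N}. (norm (w (s + 1) - r s))\<^sup>2) / 3)"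
      using M by (intro mult_left_mono) auto
    then have "real N * (real N - 1) / 2 * gap_Q G H J (wag N) u
        \<le> 3 * M / 2 * ((norm (r 1 - u))\<^sup>2 - (norm (r N - u))\<^sup>2)"
      using weighted_gap_bound[OF N u] by (simp add: algebra_simps)
    then have "gap_Q G H J (wag N) u \<le> c / 2 * ((norm (r 1 - u))\<^sup>2 - (norm (r N - u))\<^sup>2)"
      using assms(1) by (simp add: c_def field_simps)
    also have "(norm (r 1 - u))\<^sup>2 - (norm (r N - u))\<^sup>2
        = (norm (r 1 - wag N))\<^sup>2 - (norm (r N - wag N))\<^sup>2 + 2 * ((r 1 - r N) \<bullet> (wag N - u))"
      by (simp add: power2_norm_eq_inner inner_diff_left inner_diff_right inner_commute)
    finally show ?thesis
      by (simp add: v_def \<epsilon>_def algebra_simps)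
  qed
  \<comment> \<open>At \<open>u = wag N\<close> both the gap and the perturbation vanish, so the
    bound just proved reads \<open>0 \<le> \<epsilon>\<close>.\<close>
  have "0 \<le> \<epsilon>"
    using gap[of "wag N"] iterates_in[OF N] by (simp add: gap_Q_def)
  moreover have "perturbed_gap Z G H J (wag N) v \<le> ereal \<epsilon>"
    unfolding perturbed_gap_def using gap by (auto intro: SUP_least)
  moreover have "norm v \<le> 2 * c * D"
  proof -
    have "norm (r 1 - r N) \<le> norm (r 1 - ustar) + norm (r N - ustar)"
      using norm_triangle_ineq4[of "r 1 - ustar" "r N - ustar"] by simp
    also have "\<dots> \<le> 2 * D"
      using r_bound[OF N] by (simp add: D_def)
    finally show ?thesis
      using c by (simp add: v_def)
  qed
  moreover have "\<epsilon> \<le> 15 / 2 * c * D\<^sup>2"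
  proof -
    have "norm (r 1 - wag N) \<le> norm (r 1 - ustar) + norm (wag N - ustar)"
      using norm_triangle_ineq4[of "r 1 - ustar" "wag N - ustar"] by simp
    also have "\<dots> \<le> 19 / 5 * D"
      using wag_bound[OF N] by (simp add: D_def)
    finally have "(norm (r 1 - wag N))\<^sup>2 \<le> (19 / 5 * D)\<^sup>2"
      by (intro power_mono) auto
    also have "\<dots> \<le> 15 * D\<^sup>2"
      by (simp add: power2_eq_square)
    finally have "c / 2 * ((norm (r 1 - wag N))\<^sup>2 - (norm (r N - wag N))\<^sup>2) \<le> c / 2 * (15 * D\<^sup>2)"
      using c zero_le_power2[of "norm (r N - wag N)"] by (intro mult_left_mono) linarith+
    then show ?thesis by (simp add: \<epsilon>_def)
  qed
  ultimately show ?thesis by blast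
qed

end

end

theorem corollary2p4:
  fixes Z :: "'a::euclidean_space set"
    and G :: "'a \<Rightarrow> real" and gradG :: "'a \<Rightarrow> 'a"
    and H :: "'a \<Rightarrow> 'a"
    and J :: "'a \<Rightarrow> real" and J' :: "'a \<Rightarrow> 'a"
    and V :: "'a \<Rightarrow> 'a \<Rightarrow> real"
    and L\<^sub>G L\<^sub>H D :: real
    and \<alpha> \<gamma> :: "nat \<Rightarrow> real"
    and N :: nat
    and r w wag wmd :: "nat \<Rightarrow> 'a"
    and ustar :: 'a
  assumes Z: "Z \<noteq> {}" "closed Z" "convex Z"
    and G_deriv: "\<And>v. v \<in> Z \<Longrightarrow> (G has_derivative (\<lambda>h. gradG v \<bullet> h)) (at v within Z)"
    and G_cont: "continuous_on Z gradG"
    and G_lower: "\<And>w v. w \<in> Z \<Longrightarrow> v \<in> Z \<Longrightarrow> 0 \<le> G w - G v - gradG v \<bullet> (w - v)"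
    and G_upper: "\<And>w v. w \<in> Z \<Longrightarrow> v \<in> Z \<Longrightarrow>
                    G w - G v - gradG v \<bullet> (w - v) \<le> L\<^sub>G / 2 * (norm (w - v))\<^sup>2"
    and H_mono: "\<And>w v. w \<in> Z \<Longrightarrow> v \<in> Z \<Longrightarrow> 0 \<le> (H w - H v) \<bullet> (w - v)"
    and H_lipschitz: "\<And>w v. w \<in> Z \<Longrightarrow> v \<in> Z \<Longrightarrow> norm (H w - H v) \<le> L\<^sub>H * norm (w - v)"
    and J_convex: "convex_on Z J"
    and J_subgradient: "\<And>u. u \<in> Z \<Longrightarrow> J' u \<in> subdifferential Z J u"
    and prox: "prox_well_defined Z V J"
    and V: "\<And>r z. r \<in> Z \<Longrightarrow> z \<in> Z \<Longrightarrow> V r z = (norm (z - r))\<^sup>2 / 2"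
    and L\<^sub>H_pos: "L\<^sub>H > 0"
    and solution: "strong_solution Z (vi_operator gradG H J') ustar"
    and N: "N \<ge> 2"
    and \<alpha>: "\<And>t. t \<in> {1..<N} \<Longrightarrow> \<alpha> t = 2 / (real t + 1)"
    and \<gamma>: "\<And>t. t \<in> {1..<N} \<Longrightarrow> \<gamma> t = real t / (3 * (L\<^sub>G + L\<^sub>H * real N))"
    and amp: "amp_method Z V gradG H J \<alpha> \<gamma> N r w wag wmd"
    and D: "D = norm (r 1 - ustar)"
  shows "\<exists>v \<epsilon>. \<epsilon> \<ge> 0 \<and> perturbed_gap Z G H J (wag N) v \<le> ereal \<epsilon> \<and>
           norm v \<le> (12 * L\<^sub>G / (real N * (real N - 1)) + 12 * L\<^sub>H / (real N - 1)) * D \<and>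
           \<epsilon> \<le> (45 * L\<^sub>G / (real N * (real N - 1)) + 45 * L\<^sub>H / (real N - 1)) * D\<^sup>2"
proof (cases "\<exists>z. Z = {z}")
  text \<open>On a singleton \<open>L\<^sub>G\<close> may be negative and the stepsizes need not be positive.\<close>
  case True
  then obtain z where z: "Z = {z}" by blast
  have u: "ustar = z" "r 1 = z" using solution amp z by (auto simp: strong_solution_def amp_method_def)
  have "wag t = z" if "t \<in> {1..N}" for t
    using that
  proof (induction t)
    case (Suc t)
    show ?case
    proof (cases "t = 0")
      case True
      then show ?thesis using amp u by (simp add: amp_method_def)
    next
      case False
      then show ?thesis
        using Suc amp z
        by (simp add: amp_method_def prox_mapping_def arg_min_on_singleton flip: scaleR_add_left)
    qed
  qed simp
  then have "wag N = z" using N by simp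
  then have "perturbed_gap Z G H J (wag N) 0 \<le> ereal 0"
    by (simp add: perturbed_gap_def gap_Q_def z)
  \<comment> \<open>Here \<open>D = 0\<close>, so both bounds hold with zero witnesses whatever the
    sign of their coefficients.\<close>
  then show ?thesis
    using D u by (intro exI[of _ 0]) simp
next
  case False
  then obtain x y where xy: "x \<in> Z" "y \<in> Z" "x \<noteq> y" using Z(1) by blast
  \<comment> \<open>Two distinct points sandwich the linearization error of \<open>G\<close>, which
    forces \<open>L\<^sub>G\<close> to be nonnegative; in \<open>amp_run\<close> this makes
    \<open>M\<close> and the stepsizes positive.\<close>
  then have "0 \<le> L\<^sub>G / 2 * (norm (x - y))\<^sup>2"
    using G_lower[of x y] G_upper[of x y] by linarith
  then have "0 \<le> L\<^sub>G"
    using xy by (simp add: zero_le_mult_iff)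
  then interpret amp_run Z G gradG H J V L\<^sub>G L\<^sub>H \<alpha> \<gamma> N r w wag wmd
    by unfold_locales (use assms in auto)
  let ?c = "6 * M / (real N * (real N - 1))"
  have "6 * L\<^sub>H / (real N - 1) = 6 * (L\<^sub>H * real N) / (real N * (real N - 1))"
    using N by simp
  then have c: "?c = 6 * L\<^sub>G / (real N * (real N - 1)) + 6 * L\<^sub>H / (real N - 1)"
    by (simp only: M_def distrib_left add_divide_distrib)
  have "J' ustar \<in> subdifferential Z J ustar"
    using solution J_subgradient by (simp add: strong_solution_def)
  from perturbed_gap_bounds[OF solution this N] D
  obtain v \<epsilon> where "0 \<le> \<epsilon>" "perturbed_gap Z G H J (wag N) v \<le> ereal \<epsilon>"
    "norm v \<le> 2 * ?c * D" "\<epsilon> \<le> 15 / 2 * ?c * D\<^sup>2" by blast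
  \<comment> \<open>The stated constants are \<open>12 = 2 * 6\<close> and
    \<open>45 = 15 / 2 * 6\<close>.\<close>
  moreover have "2 * ?c = 12 * L\<^sub>G / (real N * (real N - 1)) + 12 * L\<^sub>H / (real N - 1)"
    unfolding c by simp
  moreover have "15 / 2 * ?c = 45 * L\<^sub>G / (real N * (real N - 1)) + 45 * L\<^sub>H / (real N - 1)"
    unfolding c by (simp add: distrib_left)
  ultimately show ?thesis by metis
qed

end
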